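(* The cuspless spatial projections of sub-Riemannian geodesics of $\mathbf{P_{mec}}$ with $\lambda_1^2(0)+\lambda_2^2(0)+\lambda_3^2(0)\ne0$ have a monotonically increasing component along $\mathfrak c^{-1}(\lambda_1(0)\mathbf e_x+\lambda_2(0)\mathbf e_y+\lambda_3(0)\mathbf e_z)$. Hence they do not self intersect or roll up.
   Context: Throughout $\xi=1$. $\mathbf{P_{mec}}$ is the sub-Riemannian problem on $SE(3)/(\{\mathbf 0\}\times SO(2))$ lifting the problem of minimizing $\int_0^L\sqrt{1+\kappa^2}\,ds$ in $\mathbb R^3$. Its cuspless geodesics $\gamma=(\mathbf x,R)$ (sixth momentum component $\lambda_6=0$) are described in spatial arclength $s$ as follows. The momentum is $\lambda_1(s)=\lambda_1(0)\cosh s-\lambda_5(0)\sinh s$, $\lambda_5(s)=\lambda_5(0)\cosh s-\lambda_1(0)\sinh s$, $\lambda_2(s)=\lambda_2(0)\cosh s+\lambda_4(0)\sinh s$, $\lambda_4(s)=\lambda_4(0)\cosh s+\lambda_2(0)\sinh s$, $\lambda_3(s)=\sqrt{1-\lambda_4(s)^2-\lambda_5(s)^2}$, with $\lambda_4(0)^2+\lambda_5(0)^2\le1$; $s_{max}\in(0,\infty]$ is the minimal $s>0$ with $\lambda_3(s)=0$; $\gamma(0)=(\mathbf 0,I)$ and for $0<s<s_{max}$ $$\mathbf x'(s)=R(s)\mathbf e_z,\qquad R'(s)=\frac1{\lambda_3(s)}R(s)\begin{pmatrix}0&0&\lambda_5(s)\\0&0&-\lambda_4(s)\\-\lambda_5(s)&\lambda_4(s)&0\end{pmatrix}.$$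 The spatial projection is $\mathbf x(\cdot)$; $\mathfrak c=\sqrt{\lambda_1^2+\lambda_2^2+\lambda_3^2}$ is a first integral. $\mathbf e_x,\mathbf e_y,\mathbf e_z$ is the standard basis of $\mathbb R^3$. *)

theory Defs
  imports "HOL-Analysis.Analysis"
begin

text \<open>
  Momenta \<open>s \<mapsto> (\<lambda>\<^sub>1(s), \<dots>, \<lambda>\<^sub>6(s))\<close> are functions
  \<open>lam :: real \<Rightarrow> real^6\<close>; all parametrizations are by spatial arclength \<open>s\<close>.
\<close>

definition pmec_momentum :: "(real \<Rightarrow> real^6) \<Rightarrow> bool" where
  "pmec_momentum lam \<longleftrightarrow>
     (lam 0 $ 4)\<^sup>2 + (lam 0 $ 5)\<^sup>2 \<le> 1 \<and>
     (\<forall>s.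
       lam s $ 1 = lam 0 $ 1 * cosh s - lam 0 $ 5 * sinh s \<and>
       lam s $ 5 = lam 0 $ 5 * cosh s - lam 0 $ 1 * sinh s \<and>
       lam s $ 2 = lam 0 $ 2 * cosh s + lam 0 $ 4 * sinh s \<and>
       lam s $ 4 = lam 0 $ 4 * cosh s + lam 0 $ 2 * sinh s \<and>
       lam s $ 3 = sqrt (1 - (lam s $ 4)\<^sup>2 - (lam s $ 5)\<^sup>2) \<and>
       lam s $ 6 = 0)"

text \<open>
  The infimum of the empty set is \<open>\<infinity>\<close>. If there are zeros of \<open>\<lambda>\<^sub>3\<close> on \<open>(0,\<infinity>)\<close>, the infimum
  is attained: \<open>\<lambda>\<^sub>4\<^sup>2 + \<lambda>\<^sub>5\<^sup>2\<close> is identically zero or strictly convex in \<open>s\<close>, so there are at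
  most two zeros.
\<close>

definition s_max :: "(real \<Rightarrow> real^6) \<Rightarrow> ereal" where
  "s_max lam = Inf (ereal ` {s. 0 < s \<and> lam s $ 3 = 0})"

definition geodesic_dom :: "(real \<Rightarrow> real^6) \<Rightarrow> real set" where
  "geodesic_dom lam = {s. 0 \<le> s \<and> ereal s < s_max lam}"

definition first_integral :: "(real \<Rightarrow> real^6) \<Rightarrow> real \<Rightarrow> real" where
  "first_integral lam s = sqrt ((lam s $ 1)\<^sup>2 + (lam s $ 2)\<^sup>2 + (lam s $ 3)\<^sup>2)"

definition e_x :: "real^3" where "e_x = axis 1 1"
definition e_y :: "real^3" where "e_y = axis 2 1"
definition e_z :: "real^3" where "e_z = axis 3 1"

definition generator :: "(real \<Rightarrow> real^6) \<Rightarrow> real \<Rightarrow> real^3^3" where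
  "generator lam s = vector
     [vector [0, 0, lam s $ 5],
      vector [0, 0, - lam s $ 4],
      vector [- lam s $ 5, lam s $ 4, 0]]"

text \<open>
  The condition \<open>\<lambda>\<^sub>4\<^sup>2 + \<lambda>\<^sub>5\<^sup>2 \<le> 1\<close> on the whole domain says that the square root defining
  \<open>\<lambda>\<^sub>3\<close> is real there; it has to be stated because \<^const>\<open>sqrt\<close> is total, with
  \<open>sqrt (- r) = - sqrt r\<close>. It fails on \<open>(0, s_max)\<close> only for curves with \<open>\<lambda>\<^sub>3(0) = 0\<close> whose
  \<open>\<lambda>\<^sub>3\<close> is imaginary immediately after \<open>0\<close>. Differential equations are imposed on the open
  interval, and the initial values by continuity, since \<open>1 / \<lambda>\<^sub>3\<close> may be singular at \<open>0\<close>.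
\<close>

definition cuspless_geodesic ::
  "(real \<Rightarrow> real^6) \<Rightarrow> (real \<Rightarrow> real^3) \<Rightarrow> (real \<Rightarrow> real^3^3) \<Rightarrow> bool" where
  "cuspless_geodesic lam x R \<longleftrightarrow>
     pmec_momentum lam \<and>
     (\<forall>s\<in>geodesic_dom lam. (lam s $ 4)\<^sup>2 + (lam s $ 5)\<^sup>2 \<le> 1) \<and>
     (\<forall>s\<in>geodesic_dom lam. rotation_matrix (R s)) \<and>
     x 0 = 0 \<and> R 0 = mat 1 \<and>
     continuous_on (geodesic_dom lam) x \<and>
     continuous_on (geodesic_dom lam) R \<and>
     (\<forall>s. 0 < s \<and> ereal s < s_max lam \<longrightarrow>
        (x has_vector_derivative (R s *v e_z)) (at s) \<and>
        (R has_vector_derivative ((1 / lam s $ 3) *\<^sub>R (R s ** generator lam s))) (at s))"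

text \<open>
  A curve rolls up if its direction of travel turns around so far that forward tangent vectors
  can be positively combined to zero. For a regular planar \<open>C\<^sup>1\<close> curve this means that the
  tangent directions contain a closed half-circle; for a regular \<open>C\<^sup>1\<close> curve on a compact
  interval, in any dimension, that they lie in no open half-space. Not rolling up in this sense
  excludes in particular every complete turn of a planar arc, spirals included.
\<close>

definition rolls_up :: "real set \<Rightarrow> (real \<Rightarrow> 'a::real_normed_vector) \<Rightarrow> bool" where
  "rolls_up I x \<longleftrightarrow> 0 \<in> convex hull ((\<lambda>s. vector_derivative x (at s within I)) ` I)"

end

theory Submission
  imports Defs
begin

text \<open>
  Put \<open>w = (\<lambda>\<^sub>1, \<lambda>\<^sub>2, \<lambda>\<^sub>3)\<close>. The momentum equations say \<open>w' = - \<lambda>\<^sub>3\<^sup>-\<^sup>1 G w\<close>, where \<open>G\<close> is the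
  generator matrix, so that \<open>R w\<close> is constantly equal to \<open>w(0)\<close>. Since \<open>R\<close> is orthogonal,
  \<open>x' \<bullet> w(0) = (R e\<^sub>z) \<bullet> (R w) = \<lambda>\<^sub>3\<close>, which is positive away from \<open>s = 0\<close>. Thus the component
  along \<open>w(0)\<close> increases strictly, and all tangents lie in the convex set consisting of the
  open half-space \<open>v \<bullet> w(0) > 0\<close> and the point \<open>e\<^sub>z\<close>, which does not contain \<open>0\<close>. The extra
  point is needed because the initial tangent \<open>e\<^sub>z\<close> is orthogonal to \<open>w(0)\<close> if \<open>\<lambda>\<^sub>3(0) = 0\<close>.
\<close>

section \<open>General facts on rotations, half-spaces and one-sided derivatives\<close>

lemma bounded_bilinear_matrix_vector_mult:
  "bounded_bilinear ((*v) :: real^'n^'m \<Rightarrow> real^'n \<Rightarrow> real^'m)"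
proof -
  have "linear (\<lambda>A::real^'n^'m. A *v x)" for x
    by (rule linearI)
      (simp_all add: matrix_vector_mult_add_rdistrib scaleR_matrix_vector_assoc)
  then show ?thesis
    by (simp add: bilinear_conv_bounded_bilinear[symmetric] bilinear_def)
qed

lemma rotation_matrix_inner:
  fixes A :: "real^'n^'n"
  assumes "rotation_matrix A"
  shows "(A *v v) \<bullet> (A *v w) = v \<bullet> w"
  using assms
  by (metis dot_lmul_matrix matrix_vector_mul_assoc matrix_vector_mul_lid orthogonal_matrix_def
      rotation_matrix_def transpose_matrix_vector)

text \<open>If both weights are positive and the points are not both \<open>e\<close>, one of them
  pairs strictly positively with \<open>a\<close> and the other nonnegatively. In all other cases
  the combination is one of the two points.\<close>

lemma convex_insert_open_halfspace:
  fixes a e :: "'a::real_inner"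
  assumes "0 \<le> e \<bullet> a"
  shows "convex (insert e {v. 0 < v \<bullet> a})"
proof (rule convexI)
  fix y z :: 'a and u v :: real
  assume y: "y \<in> insert e {v. 0 < v \<bullet> a}" and z: "z \<in> insert e {v. 0 < v \<bullet> a}"
    and uv: "0 \<le> u" "0 \<le> v" "u + v = 1"
  show "u *\<^sub>R y + v *\<^sub>R z \<in> insert e {v. 0 < v \<bullet> a}"
  proof (cases "u = 0 \<or> v = 0 \<or> y = e \<and> z = e")
    case True
    then show ?thesis
      using y z uv by (auto simp flip: scaleR_add_left)
  next
    case False
    then have "0 < u" "0 < v" using uv by auto
    moreover have "0 \<le> y \<bullet> a" "0 \<le> z \<bullet> a" "0 < y \<bullet> a \<or> 0 < z \<bullet> a"
      using False y z assms by auto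
    ultimately have "0 < u * (y \<bullet> a) + v * (z \<bullet> a)"
      by (auto intro: add_pos_nonneg add_nonneg_pos)
    then show ?thesis by (simp add: inner_add_left)
  qed
qed

text \<open>By the fundamental theorem of calculus \<open>f\<close> is \<open>f a\<close> plus the
  integral of \<open>f'\<close>, which is differentiable at \<open>a\<close> by continuity of
  \<open>f'\<close>. This yields the tangent at 0, where no differential equation is
  imposed.\<close>

lemma has_vector_derivative_left_endpoint:
  fixes f f' :: "real \<Rightarrow> 'a::banach"
  assumes "a < b" and "continuous_on {a..b} f" and "continuous_on {a..b} f'"
    and "\<And>s. s \<in> {a<..<b} \<Longrightarrow> (f has_vector_derivative f' s) (at s)"
  shows "(f has_vector_derivative f' a) (at a within {a..b})"
proof -
  have f: "f u = f a + integral {a..u} f'" if "u \<in> {a..b}" for u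
  proof -
    have "(f' has_integral (f u - f a)) {a..u}"
      using that assms
      by (intro fundamental_theorem_of_calculus_interior) (auto intro: continuous_on_subset)
    then show ?thesis by (simp add: integral_unique)
  qed
  have "((\<lambda>u. f a + integral {a..u} f') has_vector_derivative f' a) (at a within {a..b})"
    using integral_has_vector_derivative[OF assms(3), of a] \<open>a < b\<close>
    by (auto intro!: derivative_eq_intros)
  then show ?thesis
    by (rule has_vector_derivative_transform[rotated 2])
      (use \<open>a < b\<close> in simp, erule f)
qed

section \<open>The domain of a geodesic\<close>

lemma convex_geodesic_dom: "convex (geodesic_dom lam)"
  unfolding is_interval_convex_1[symmetric] is_interval_1 geodesic_dom_def
  by (auto intro: le_less_trans[OF ereal_less_eq(3)[THEN iffD2]])

lemma geodesic_dom_extend: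
  assumes "s \<in> geodesic_dom lam"
  obtains b where "s < b" "b \<in> geodesic_dom lam"
proof -
  obtain q where "ereal s < q" "q < s_max lam"
    using assms dense by (auto simp: geodesic_dom_def)
  then show thesis
    using that assms by (cases q) (auto simp: geodesic_dom_def)
qed

text \<open>A positive zero of the third component is at least the infimum
  \<open>s_max\<close>.\<close>

lemma geodesic_dom_nonzero:
  assumes "s \<in> geodesic_dom lam" "0 < s"
  shows "lam s $ 3 \<noteq> 0"
  using assms unfolding geodesic_dom_def s_max_def
  by (auto dest: less_INF_D)

section \<open>The spatial part of the momentum and its evolution\<close>

definition linear_momentum :: "(real \<Rightarrow> real^6) \<Rightarrow> real \<Rightarrow> real^3" where
  "linear_momentum lam s = vector [lam s $ 1, lam s $ 2, lam s $ 3]"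

lemma linear_momentum_eq:
  "linear_momentum lam s = lam s $ 1 *\<^sub>R e_x + lam s $ 2 *\<^sub>R e_y + lam s $ 3 *\<^sub>R e_z"
  by (simp add: linear_momentum_def e_x_def e_y_def e_z_def vec_eq_iff forall_3 axis_def)

lemma e_z_inner_linear_momentum: "e_z \<bullet> linear_momentum lam s = lam s $ 3"
  by (simp add: e_z_def inner_axis' linear_momentum_def)

lemma pmec_momentum_derivs:
  assumes "pmec_momentum lam"
  shows "((\<lambda>s. lam s $ 1) has_real_derivative - lam s $ 5) (at s)"
    and "((\<lambda>s. lam s $ 2) has_real_derivative lam s $ 4) (at s)"
    and "((\<lambda>s. lam s $ 4) has_real_derivative lam s $ 2) (at s)"
    and "((\<lambda>s. lam s $ 5) has_real_derivative - lam s $ 1) (at s)"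
proof -
  \<comment> \<open>The initial values become constants; otherwise the right-hand sides would
    contain further instances of the left-hand sides.\<close>
  obtain l1 l2 l4 l5 where eqs:
    "\<And>s. lam s $ 1 = l1 * cosh s - l5 * sinh s" "\<And>s. lam s $ 5 = l5 * cosh s - l1 * sinh s"
    "\<And>s. lam s $ 2 = l2 * cosh s + l4 * sinh s" "\<And>s. lam s $ 4 = l4 * cosh s + l2 * sinh s"
    using assms unfolding pmec_momentum_def by blast
  show "((\<lambda>s. lam s $ 1) has_real_derivative - lam s $ 5) (at s)"
    unfolding eqs(1,2) by (auto intro!: derivative_eq_intros)
  show "((\<lambda>s. lam s $ 2) has_real_derivative lam s $ 4) (at s)"
    unfolding eqs(3,4) by (auto intro!: derivative_eq_intros)
  show "((\<lambda>s. lam s $ 4) has_real_derivative lam s $ 2) (at s)"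
    unfolding eqs(3,4) by (auto intro!: derivative_eq_intros)
  show "((\<lambda>s. lam s $ 5) has_real_derivative - lam s $ 1) (at s)"
    unfolding eqs(1,2) by (auto intro!: derivative_eq_intros)
qed

lemma pmec_momentum_third:
  "pmec_momentum lam \<Longrightarrow> lam s $ 3 = sqrt (1 - (lam s $ 4)\<^sup>2 - (lam s $ 5)\<^sup>2)"
  unfolding pmec_momentum_def by blast

lemma continuous_linear_momentum:
  assumes "pmec_momentum lam"
  shows "continuous_on S (linear_momentum lam)"
proof -
  have "continuous_on S (\<lambda>s. lam s $ 1)" "continuous_on S (\<lambda>s. lam s $ 2)"
    "continuous_on S (\<lambda>s. lam s $ 4)" "continuous_on S (\<lambda>s. lam s $ 5)"
    using pmec_momentum_derivs[OF assms]
    by (meson DERIV_isCont continuous_at_imp_continuous_on)+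
  then show ?thesis
    unfolding linear_momentum_eq pmec_momentum_third[OF assms]
    by (intro continuous_on_add continuous_on_scaleR continuous_on_real_sqrt continuous_on_diff
        continuous_on_power continuous_on_const)
qed

lemma linear_momentum_deriv:
  assumes "pmec_momentum lam" "0 < lam s $ 3"
  shows "(linear_momentum lam has_vector_derivative
      - ((1 / lam s $ 3) *\<^sub>R (generator lam s *v linear_momentum lam s))) (at s)"
proof -
  note d = pmec_momentum_derivs[OF assms(1), of s]
  \<comment> \<open>Away from zeros of the radicand the square root is differentiable.\<close>
  have pos: "0 < 1 - (lam s $ 4)\<^sup>2 - (lam s $ 5)\<^sup>2"
    using assms(2) unfolding pmec_momentum_third[OF assms(1)] by simp
  have d3: "((\<lambda>s. lam s $ 3) has_real_derivative
      (lam s $ 5 * lam s $ 1 - lam s $ 4 * lam s $ 2) / lam s $ 3) (at s)"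
    unfolding pmec_momentum_third[OF assms(1)]
    using pos by (auto intro!: derivative_eq_intros d simp: field_simps)
  have "(linear_momentum lam has_vector_derivative
      (- lam s $ 5) *\<^sub>R e_x + lam s $ 4 *\<^sub>R e_y
        + ((lam s $ 5 * lam s $ 1 - lam s $ 4 * lam s $ 2) / lam s $ 3) *\<^sub>R e_z) (at s)"
    unfolding linear_momentum_eq by (auto intro!: derivative_eq_intros d d3)
  moreover have "(- lam s $ 5) *\<^sub>R e_x + lam s $ 4 *\<^sub>R e_y
        + ((lam s $ 5 * lam s $ 1 - lam s $ 4 * lam s $ 2) / lam s $ 3) *\<^sub>R e_z
      = - ((1 / lam s $ 3) *\<^sub>R (generator lam s *v linear_momentum lam s))"
    using assms(2)
    by (simp add: e_x_def e_y_def e_z_def axis_def vec_eq_iff forall_3 generator_def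
        linear_momentum_def matrix_vector_mult_def sum_3 field_simps)
  ultimately show ?thesis by simp
qed

section \<open>The conserved vector and the tangents along a geodesic\<close>

locale cuspless =
  fixes lam :: "real \<Rightarrow> real^6" and x :: "real \<Rightarrow> real^3" and R :: "real \<Rightarrow> real^3^3"
  assumes geodesic: "cuspless_geodesic lam x R"
begin

abbreviation "I \<equiv> geodesic_dom lam"
abbreviation "w \<equiv> linear_momentum lam"

lemma momentum: "pmec_momentum lam"
  and rotation: "s \<in> I \<Longrightarrow> rotation_matrix (R s)"
  and R_0: "R 0 = mat 1"
  and continuous_x: "continuous_on I x"
  and continuous_R: "continuous_on I R"
  and x_deriv: "s \<in> I \<Longrightarrow> 0 < s \<Longrightarrow> (x has_vector_derivative (R s *v e_z)) (at s)"
  and R_deriv: "s \<in> I \<Longrightarrow> 0 < s \<Longrightarrow>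
        (R has_vector_derivative ((1 / lam s $ 3) *\<^sub>R (R s ** generator lam s))) (at s)"
  using geodesic by (auto simp: cuspless_geodesic_def geodesic_dom_def)

text \<open>The bound on the fourth and fifth components over the domain makes the radicand
  nonnegative; \<open>sqrt\<close> alone would allow negative values.\<close>

lemma third_nonneg: "0 \<le> lam s $ 3" if "s \<in> I"
  using geodesic that unfolding pmec_momentum_third[OF momentum]
  by (auto simp: cuspless_geodesic_def algebra_simps)

lemma third_pos: "0 < lam s $ 3" if "s \<in> I" "0 < s"
  using third_nonneg[OF that(1)] geodesic_dom_nonzero[OF that] by simp

lemma segment_subset: "{a..b} \<subseteq> I" if "a \<in> I" "b \<in> I"
  using that convex_geodesic_dom by (metis closed_segment_eq_real_ivl convex_contains_segment
      atLeastatMost_empty_iff empty_subsetI)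

lemma zero_in_dom: "0 \<in> I" if "s \<in> I"
  using that by (auto simp: geodesic_dom_def intro: le_less_trans[OF ereal_less_eq(3)[THEN iffD2]])

lemma dom_nonneg: "0 \<le> s" if "s \<in> I"
  using that by (simp add: geodesic_dom_def)

lemma rotated_momentum_constant:
  assumes "s \<in> I"
  shows "R s *v w s = w 0"
\<comment> \<open>The exceptional set is \<open>{0}\<close>: there \<open>1 / lam s $ 3\<close> may
  be singular, and continuity suffices.\<close>
proof (rule has_derivative_zero_unique_strong_interval[where a = 0 and b = s and k = "{0}"])
  interpret bounded_bilinear "(*v) :: real^3^3 \<Rightarrow> real^3 \<Rightarrow> real^3"
    by (rule bounded_bilinear_matrix_vector_mult)
  note sub = segment_subset[OF zero_in_dom[OF assms] assms]
  show "continuous_on {0..s} (\<lambda>s. R s *v w s)"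
    by (intro continuous_on continuous_on_subset[OF continuous_R sub]
        continuous_linear_momentum momentum)
  show "R 0 *v w 0 = w 0"
    by (simp add: R_0)
  show "((\<lambda>s. R s *v w s) has_derivative (\<lambda>h. 0)) (at t within {0..s})"
    if "t \<in> {0..s} - {0}" for t
  proof -
    have t: "t \<in> I" "0 < t" using that sub by auto
    \<comment> \<open>Product rule; the two terms are opposite to each other.\<close>
    have "((\<lambda>s. R s *v w s) has_vector_derivative
        R t *v - ((1 / lam t $ 3) *\<^sub>R (generator lam t *v w t))
        + ((1 / lam t $ 3) *\<^sub>R (R t ** generator lam t)) *v w t) (at t)"
      by (intro has_vector_derivative R_deriv linear_momentum_deriv momentum third_pos t)
    then have "((\<lambda>s. R s *v w s) has_vector_derivative 0) (at t)"
      by (simp add: scaleR_left scaleR_right minus_right matrix_vector_mul_assoc)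
    then show ?thesis
      by (simp add: has_vector_derivative_def has_derivative_at_withinI)
  qed
qed (use dom_nonneg[OF assms] in auto)

lemma tangent_inner_momentum:
  assumes "s \<in> I"
  shows "(R s *v e_z) \<bullet> w 0 = lam s $ 3"
  using rotation_matrix_inner[OF rotation[OF assms], of e_z "w s"]
  by (simp add: rotated_momentum_constant[OF assms] e_z_inner_linear_momentum)

lemma momentum_component_strict_mono:
  assumes "0 < c"
  shows "strict_mono_on I (\<lambda>s. x s \<bullet> (c *\<^sub>R w 0))"
proof (rule strict_mono_onI)
  fix a b assume ab: "a \<in> I" "b \<in> I" "a < b"
  note sub = segment_subset[OF ab(1,2)]
  show "x a \<bullet> (c *\<^sub>R w 0) < x b \<bullet> (c *\<^sub>R w 0)"
  \<comment> \<open>Positivity of the derivative is asked only in the interior, since the third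
    component may vanish at \<open>a = 0\<close>.\<close>
  proof (rule DERIV_pos_imp_increasing_open[OF ab(3)])
    show "continuous_on {a..b} (\<lambda>s. x s \<bullet> (c *\<^sub>R w 0))"
      by (intro continuous_intros continuous_on_subset[OF continuous_x sub])
    fix s assume s: "a < s" "s < b"
    then have sI: "s \<in> I" "0 < s" using sub dom_nonneg[OF ab(1)] by auto
    have "((\<lambda>s. x s \<bullet> (c *\<^sub>R w 0)) has_vector_derivative (R s *v e_z) \<bullet> (c *\<^sub>R w 0)) (at s)"
      by (rule bounded_linear.has_vector_derivative[OF bounded_linear_inner_left x_deriv[OF sI]])
    then have "((\<lambda>s. x s \<bullet> (c *\<^sub>R w 0)) has_real_derivative c * lam s $ 3) (at s)"
      by (simp add: has_real_derivative_iff_has_vector_derivative tangent_inner_momentum sI)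
    then show "\<exists>y. ((\<lambda>s. x s \<bullet> (c *\<^sub>R w 0)) has_real_derivative y) (at s) \<and> 0 < y"
      using third_pos[OF sI] assms by (auto intro: mult_pos_pos)
  qed
qed

lemma x_deriv_within:
  assumes "s \<in> I"
  shows "(x has_vector_derivative R s *v e_z) (at s within I)"
proof (cases "s = 0")
  case False
  then show ?thesis
    using x_deriv[OF assms] dom_nonneg[OF assms] by (auto intro: has_vector_derivative_at_within)
next
  case True
  obtain b where b: "0 < b" "b \<in> I"
    using geodesic_dom_extend[OF zero_in_dom[OF assms]] .
  note sub = segment_subset[OF zero_in_dom[OF assms] b(2)]
  have "(x has_vector_derivative R 0 *v e_z) (at 0 within {0..b})"
  proof (rule has_vector_derivative_left_endpoint[OF b(1)])
    show "continuous_on {0..b} (\<lambda>s. R s *v e_z)"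
      by (intro bounded_bilinear.continuous_on[OF bounded_bilinear_matrix_vector_mult]
          continuous_on_subset[OF continuous_R sub] continuous_on_const)
  qed (use sub in \<open>auto intro!: x_deriv continuous_on_subset[OF continuous_x]\<close>)
  \<comment> \<open>The domain has no negative points, so below \<open>b\<close> it coincides with
    \<open>{0..b}\<close>.\<close>
  moreover have "at 0 within {0..b} = at 0 within I"
    using sub dom_nonneg b(1) by (intro at_within_nhd[of _ "{..<b}"]) auto
  ultimately show ?thesis using True by simp
qed

text \<open>The derivative within \<open>I\<close> is unique because \<open>I\<close> contains an
  interval to the right of each of its points, so the filter is nontrivial.\<close>

lemma vector_derivative_x:
  assumes "s \<in> I"
  shows "vector_derivative x (at s within I) = R s *v e_z"
proof (rule vector_derivative_within[OF _ x_deriv_within[OF assms]])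
  obtain b where "s < b" "b \<in> I"
    using geodesic_dom_extend[OF assms] .
  then have "at s within {s<..<b} \<noteq> bot" "{s<..<b} \<subseteq> I"
    using segment_subset[OF assms, of b] by (auto simp: at_within_eq_bot_iff)
  then show "at s within I \<noteq> bot"
    using at_le[of "{s<..<b}" I s] by (auto simp: le_bot)
qed

lemma not_rolls_up: "\<not> rolls_up I x"
proof
  let ?K = "insert e_z {v. 0 < v \<bullet> w 0}"
  let ?T = "(\<lambda>s. vector_derivative x (at s within I)) ` I"
  assume "rolls_up I x"
  then have zero: "0 \<in> convex hull ?T" by (simp add: rolls_up_def)
  \<comment> \<open>The hull of the empty set is empty. Hence \<open>I\<close> has a point, and with
    it the point 0, where the sign of the third component is needed.\<close>
  then have "?T \<noteq> {}" by force
  then have "0 \<in> I" using zero_in_dom by blast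
  then have "convex ?K"
    by (intro convex_insert_open_halfspace)
      (simp add: e_z_inner_linear_momentum third_nonneg)
  moreover have "?T \<subseteq> ?K"
  proof (rule image_subsetI)
    fix s assume s: "s \<in> I"
    show "vector_derivative x (at s within I) \<in> ?K"
      using s third_pos[OF s] dom_nonneg[OF s]
      by (cases "s = 0") (simp_all add: vector_derivative_x R_0 tangent_inner_momentum)
  qed
  ultimately have "0 \<in> ?K" using hull_minimal[of ?T ?K convex] zero by blast
  \<comment> \<open>The zero vector differs from \<open>e_z\<close> and pairs to 0 with
    \<open>w 0\<close>.\<close>
  then show False by (auto simp: e_z_def axis_eq_0_iff)
qed

end

theorem corollary5:
  fixes lam :: "real \<Rightarrow> real^6" and x :: "real \<Rightarrow> real^3" and R :: "real \<Rightarrow> real^3^3"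
  assumes "cuspless_geodesic lam x R"
    and "(lam 0 $ 1)\<^sup>2 + (lam 0 $ 2)\<^sup>2 + (lam 0 $ 3)\<^sup>2 \<noteq> 0"
  shows "strict_mono_on (geodesic_dom lam)
           (\<lambda>s. x s \<bullet> ((1 / first_integral lam 0) *\<^sub>R
              (lam 0 $ 1 *\<^sub>R e_x + lam 0 $ 2 *\<^sub>R e_y + lam 0 $ 3 *\<^sub>R e_z)))
         \<and> inj_on x (geodesic_dom lam)
         \<and> \<not> rolls_up (geodesic_dom lam) x"
proof -
  interpret cuspless lam x R by standard (rule assms(1))
  have "0 < (lam 0 $ 1)\<^sup>2 + (lam 0 $ 2)\<^sup>2 + (lam 0 $ 3)\<^sup>2"
    using assms(2) by (simp add: less_le)
  then have mono: "strict_mono_on I (\<lambda>s. x s \<bullet> ((1 / first_integral lam 0) *\<^sub>R w 0))"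
    by (intro momentum_component_strict_mono) (simp add: first_integral_def)
  \<comment> \<open>A self-intersection of \<open>x\<close> would repeat a value of this strictly
    increasing component.\<close>
  then have "inj_on ((\<lambda>y. y \<bullet> ((1 / first_integral lam 0) *\<^sub>R w 0)) \<circ> x) I"
    by (simp add: strict_mono_on_imp_inj_on comp_def)
  then have "inj_on x I" by (rule inj_on_imageI2)
  with mono not_rolls_up show ?thesis
    by (simp add: linear_momentum_eq)
qed

end
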